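(* Let $d,m$ be positive integers with $m\leq d-1$ and let $M\in\mathbb{R}^{d\times d}$ be nondegenerate. Assume there exist $m$ linearly independent vectors $\bar{k}_{1},\dots,\bar{k}_{m}\in\mathbb{Z}^{d}\setminus\{0\}$ such that $\langle\bar{k}_{j},M^{-1}e_{i}\rangle=0$ for all $i=m+1,\dots,d$ and $j=1,\dots,m$. Let $P$ be the orthogonal projection of $MC_{d}$ onto $\mathbb{R}^{m}$ (the first $m$ coordinates), where $C_{d}=[-1,1]^{d}$, and define the weight function on $\mathbb{R}^{m}$ $$W_{M,m}(x_{1},\dots,x_{m})=\int_{MC_{d}\cap\mathbf{H}_{x_{1},\dots,x_{m}}}dx_{m+1}\cdots dx_{d},\qquad \mathbf{H}_{x_{1},\dots,x_{m}}=\{u\in\mathbb{R}^{d}:u_{1}=x_{1},\dots,u_{m}=x_{m}\},$$ and the set $$\Lambda=\left\{\pi\left(\langle\bar{k},M^{-1}e_{1}\rangle,\dots,\langle\bar{k},M^{-1}e_{m}\rangle\right):\bar{k}\in\mathbb{Z}^{d},\ \langle\bar{k},M^{-1}e_{i}\rangle=0,\ i=m+1,\dots,d\right\}\subset\mathbb{R}^{m}.$$ Then $E(\Lambda)=\{e^{i\langle\lambda,\cdot\rangle}\}_{\lambda\in\Lambda}$ is an infinite set of orthogonal exponentials for $P$ with respect to the weight $W_{M,m}$, i.e., $\int_{P}e^{i\langle\lambda-\lambda',x\rangle}W_{M,m}(x)\,dx=0$ for all distinct $\lambda,\lambda'\in\Lambda$, and $D(\Lambda)\geq\pi^{-d}|\det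 M|/|\det U|$, where $U\in\mathbb{R}^{d\times d}$ is the matrix whose first $m$ rows are $\bar{k}_{1}^{T},\dots,\bar{k}_{m}^{T}$ and whose remaining rows are $e_{m+1}^{T}M,\dots,e_{d}^{T}M$ (i.e., rows $m+1,\dots,d$ of $M$).
   Context: $e_{1},\dots,e_{d}$ denote the standard unit coordinate vectors. For $\Lambda\subset\mathbb{R}^{n}$ let $D^{+}(\Lambda)=\lim_{\rho\to\infty}\sup_{x\in\mathbb{R}^{n}}|\Lambda\cap(x+[0,\rho)^{n})|/\rho^{n}$ and $D^{-}(\Lambda)=\lim_{\rho\to\infty}\inf_{x\in\mathbb{R}^{n}}|\Lambda\cap(x+[0,\rho)^{n})|/\rho^{n}$; if both limits exist and are equal, their common value is the density $D(\Lambda)$. For a full-rank lattice $\Lambda=A\mathbb{Z}^{n}$, $D(\Lambda)=1/|\det A|$. *)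

theory Defs
  imports "HOL-Analysis.Analysis"
begin

text \<open>
  Conventions. With \<open>m = CARD('m)\<close> and \<open>d = CARD('m) + CARD('n)\<close>, the space \<open>\<real>\<^sup>d\<close> is
  \<^typ>\<open>real ^ ('m + 'n)\<close>: the indices \<open>Inl j\<close> stand for the coordinates \<open>1, \<dots>, m\<close> and the
  indices \<open>Inr i\<close> for the coordinates \<open>m + 1, \<dots>, d\<close>. As types are nonempty, the pairs
  \<open>(m, d)\<close> arising in this way are exactly those with \<open>1 \<le> m \<le> d - 1\<close>.
\<close>

definition int_vecs :: "(real ^ 'k) set"
  where "int_vecs = {v. \<forall>i. v $ i \<in> \<int>}"

definition std_cube :: "(real ^ 'k) set"
  where "std_cube = {x. \<forall>i. -1 \<le> x $ i \<and> x $ i \<le> 1}"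

definition cube_image :: "real ^ 'k ^ 'k \<Rightarrow> (real ^ 'k) set"
  where "cube_image M = (\<lambda>x. M *v x) ` std_cube"

definition proj_fst :: "real ^ ('m::finite + 'n::finite) \<Rightarrow> real ^ 'm"
  where "proj_fst u = (\<chi> j. u $ Inl j)"

definition join :: "real ^ 'm::finite \<Rightarrow> real ^ 'n::finite \<Rightarrow> real ^ ('m + 'n)"
  where "join x y = (\<chi> r. case r of Inl j \<Rightarrow> x $ j | Inr i \<Rightarrow> y $ i)"

definition fibre :: "real ^ 'm::finite \<Rightarrow> (real ^ ('m + 'n::finite)) set"
  where "fibre x = {u. \<forall>j. u $ Inl j = x $ j}"

text \<open>The slice \<open>M C\<^sub>d \<inter> H\<^sub>x\<close> is integrated in the last \<open>d - m\<close> coordinates \<open>y\<close>.\<close>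

definition weight :: "real ^ ('m::finite + 'n::finite) ^ ('m + 'n) \<Rightarrow> real ^ 'm \<Rightarrow> real"
  where "weight M x =
    (\<integral>y \<in> {y :: real ^ 'n. join x y \<in> cube_image M \<inter> fibre x}. 1 \<partial>lborel)"

definition freq_set :: "real ^ ('m::finite + 'n::finite) ^ ('m + 'n) \<Rightarrow> (real ^ 'm) set"
  where "freq_set M =
    {(\<chi> j. pi * (k \<bullet> (matrix_inv M *v axis (Inl j) 1))) | k.
       k \<in> int_vecs \<and> (\<forall>i. k \<bullet> (matrix_inv M *v axis (Inr i) 1) = 0)}"

definition exponential :: "real ^ 'k \<Rightarrow> real ^ 'k \<Rightarrow> complex"
  where "exponential l x = exp (\<i> * complex_of_real (l \<bullet> x))"

definition U_matrix ::
    "('m::finite \<Rightarrow> real ^ ('m + 'n::finite)) \<Rightarrow> real ^ ('m + 'n) ^ ('m + 'n) \<Rightarrow> real ^ ('m + 'n) ^ ('m + 'n)"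
  where "U_matrix k M = (\<chi> r. case r of Inl j \<Rightarrow> k j | Inr i \<Rightarrow> row (Inr i) M)"

definition half_open_cube :: "real ^ 'k \<Rightarrow> real \<Rightarrow> (real ^ 'k) set"
  where "half_open_cube x \<rho> = {y. \<forall>i. x $ i \<le> y $ i \<and> y $ i < x $ i + \<rho>}"

text \<open>
  Points are counted in \<^typ>\<open>ennreal\<close>, so that infinite intersections count as \<open>\<infinity>\<close> (rather than
  \<open>0\<close>, as with \<^const>\<open>card\<close>) and suprema always make sense.
\<close>

definition max_count_ratio :: "(real ^ 'k) set \<Rightarrow> real \<Rightarrow> ennreal"
  where "max_count_ratio L \<rho> =
    (SUP x. emeasure (count_space UNIV) (L \<inter> half_open_cube x \<rho>)) / ennreal (\<rho> ^ CARD('k))"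

definition min_count_ratio :: "(real ^ 'k) set \<Rightarrow> real \<Rightarrow> ennreal"
  where "min_count_ratio L \<rho> =
    (INF x. emeasure (count_space UNIV) (L \<inter> half_open_cube x \<rho>)) / ennreal (\<rho> ^ CARD('k))"

text \<open>
  Both limits exist and have the common finite value \<open>\<delta>\<close>. The sign condition is needed because
  \<^const>\<open>ennreal\<close> maps negative reals to \<open>0\<close>.
\<close>

definition has_density :: "(real ^ 'k) set \<Rightarrow> real \<Rightarrow> bool"
  where "has_density L \<delta> \<longleftrightarrow> 0 \<le> \<delta> \<and>
    (max_count_ratio L \<longlongrightarrow> ennreal \<delta>) at_top \<and>
    (min_count_ratio L \<longlongrightarrow> ennreal \<delta>) at_top"

end

theory Submission
  imports Defs
begin

text \<open>
  Let \<open>l\<close> be a frequency, coming from the integer vector \<open>k = M\<^sup>T (l / \<pi>, 0)\<close>. By Fubini the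
  weighted integral of \<open>e\<^bsup>i\<langle>l, x\<rangle>\<^esup>\<close> over \<open>P\<close> is the integral of \<open>e\<^bsup>i\<langle>(l, 0), u\<rangle>\<^esup>\<close> over
  \<open>M C\<^sub>d\<close>, and \<open>u = M v\<close> turns it into \<open>|det M|\<close> times the integral of \<open>e\<^bsup>i \<pi> \<langle>k, v\<rangle>\<^esup>\<close> over
  the cube \<open>C\<^sub>d\<close>, which factorises and vanishes as soon as \<open>k \<noteq> 0\<close>.

  The frequencies form a discrete subgroup of \<open>\<real>\<^sup>m\<close>. It contains the lattice \<open>G \<int>\<^sup>m\<close> spanned by
  the frequencies of the given vectors \<open>k\<^sub>j\<close>, hence is a finite union of translates of it, and its
  density is a positive integer multiple of \<open>1 / |det G|\<close>. The matrix \<open>U M\<^sup>-\<^sup>1\<close> is block diagonal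
  with blocks \<open>\<pi>\<^sup>-\<^sup>1 G\<^sup>T\<close> and the identity, so \<open>|det G| = \<pi>\<^sup>m |det U| / |det M|\<close>; the stated
  bound follows since \<open>\<pi>\<^sup>m \<le> \<pi>\<^sup>d\<close>.
\<close>

subsection \<open>Lebesgue measure on a product of coordinate spaces\<close>

lemma Basis_vec_eq_range_axis: "(Basis :: (real ^ 'k) set) = range (\<lambda>i. axis i 1)"
  by (auto simp: Basis_vec_def)

lemma prod_Basis_vec:
  "(\<Prod>b\<in>(Basis :: (real ^ 'k) set). f b) = (\<Prod>i\<in>UNIV. f (axis i 1))"
  unfolding Basis_vec_eq_range_axis
  by (subst prod.reindex) (auto simp: inj_on_def axis_eq_axis)

lemma prod_UNIV_sum:
  "(\<Prod>r\<in>(UNIV :: ('m::finite + 'n::finite) set). f r) = (\<Prod>j\<in>UNIV. f (Inl j)) * (\<Prod>i\<in>UNIV. f (Inr i))"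
  unfolding UNIV_sum
  by (subst prod.union_disjoint) (auto simp: prod.reindex)

lemma emeasure_lborel_box_vec:
  fixes l u :: "real ^ 'k"
  assumes "\<And>i. l $ i \<le> u $ i"
  shows "emeasure lborel (box l u) = ennreal (\<Prod>i\<in>UNIV. u $ i - l $ i)"
  using assms
  by (subst emeasure_lborel_box)
     (auto simp: Basis_vec_eq_range_axis inner_axis prod_Basis_vec[unfolded Basis_vec_eq_range_axis])

lemma continuous_on_join:
  "continuous_on UNIV (\<lambda>p. join (fst p) (snd p) :: real ^ ('m::finite + 'n::finite))"
  unfolding join_def
proof (intro continuous_on_vec_lambda)
  fix r :: "'m + 'n"
  show "continuous_on UNIV (\<lambda>p. case r of Inl j \<Rightarrow> (fst p :: real ^ 'm) $ j | Inr i \<Rightarrow> (snd p :: real ^ 'n) $ i)"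
    by (cases r) (auto intro!: continuous_intros)
qed

lemma measurable_join [measurable]:
  "(\<lambda>p. join (fst p) (snd p) :: real ^ ('m::finite + 'n::finite)) \<in> borel_measurable (lborel \<Otimes>\<^sub>M lborel)"
proof -
  have "(\<lambda>p. join (fst p) (snd p) :: real ^ ('m + 'n)) \<in> borel_measurable borel"
    by (rule borel_measurable_continuous_onI[OF continuous_on_join])
  then show ?thesis
    by (simp add: lborel_prod)
qed

text \<open>Makes Fubini available on the joined space. By uniqueness of Lebesgue measure it
  suffices to compare boxes, and the preimage of a box under joining is a product of two
  boxes.\<close>

lemma lborel_eq_distr_join:
  "(lborel :: (real ^ ('m::finite + 'n::finite)) measure)
     = distr (lborel \<Otimes>\<^sub>M lborel) borel (\<lambda>p. join (fst p) (snd p))"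
proof (rule lborel_eqI)
  fix l u :: "real ^ ('m + 'n)"
  assume "\<And>b. b \<in> Basis \<Longrightarrow> l \<bullet> b \<le> u \<bullet> b"
  then have le: "l $ r \<le> u $ r" for r
    by (metis Basis_vec_eq_range_axis cart_eq_inner_axis rangeI)
  define l1 u1 :: "real ^ 'm" where "l1 = (\<chi> j. l $ Inl j)" and "u1 = (\<chi> j. u $ Inl j)"
  define l2 u2 :: "real ^ 'n" where "l2 = (\<chi> i. l $ Inr i)" and "u2 = (\<chi> i. u $ Inr i)"
  have "(\<lambda>p. join (fst p) (snd p)) -` box l u = box l1 u1 \<times> box l2 u2"
    by (auto simp: mem_box_cart join_def l1_def u1_def l2_def u2_def split: sum.split)
      (metis (no_types, lifting) sum.exhaust sum.simps(5) sum.simps(6))+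
  then have "emeasure (distr (lborel \<Otimes>\<^sub>M lborel) borel (\<lambda>p. join (fst p) (snd p))) (box l u)
      = emeasure (lborel \<Otimes>\<^sub>M lborel) (box l1 u1 \<times> box l2 u2)"
    by (subst emeasure_distr) (auto simp: space_pair_measure)
  also have "\<dots> = emeasure lborel (box l1 u1) * emeasure lborel (box l2 u2)"
    by (rule lborel.emeasure_pair_measure_Times) auto
  also have "\<dots> = ennreal (\<Prod>r\<in>UNIV. u $ r - l $ r)"
    using le
    by (subst (1 2) emeasure_lborel_box_vec)
       (auto simp: l1_def u1_def l2_def u2_def prod_UNIV_sum ennreal_mult prod_nonneg)
  finally show "emeasure (distr (lborel \<Otimes>\<^sub>M lborel) borel (\<lambda>p. join (fst p) (snd p))) (box l u)
      = (\<Prod>b\<in>Basis. (u - l) \<bullet> b)"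
    by (simp add: prod_Basis_vec inner_axis)
qed simp

subsection \<open>Linear change of variables\<close>

text \<open>\<open>measure_linear_image\<close> is stated for well-ordered index types only, which excludes
  \<^typ>\<open>'m + 'n\<close>.\<close>

lemma matrix_inv_mult:
  fixes A :: "real ^ 'k ^ 'k"
  assumes "invertible A"
  shows "A ** matrix_inv A = mat 1" and "matrix_inv A ** A = mat 1"
  using assms unfolding invertible_def matrix_inv_def
  by (metis (mono_tags, lifting) someI_ex)+

lemma measurable_matrix_vmul [measurable]:
  fixes A :: "real ^ 'k ^ 'l"
  shows "(*v) A \<in> borel_measurable borel"
  by (intro borel_measurable_continuous_onI linear_continuous_on matrix_vector_mul_bounded_linear)

text \<open>In this form the change of variables reads |S| = |det A| |preimage of S under A|. It is
  stable under products because preimages compose and determinants multiply, so elementary matrices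
  are all that remains.\<close>

lemma density_distr_matrix_mult:
  fixes A B :: "real ^ 'k ^ 'k"
  assumes A: "lborel = density (distr lborel borel ((*v) A)) (\<lambda>_. ennreal \<bar>det A\<bar>)"
    and B: "lborel = density (distr lborel borel ((*v) B)) (\<lambda>_. ennreal \<bar>det B\<bar>)"
  shows "lborel = density (distr lborel borel ((*v) (A ** B))) (\<lambda>_. ennreal \<bar>det (A ** B)\<bar>)"
proof (rule measure_eqI)
  fix S :: "(real ^ 'k) set"
  assume "S \<in> sets lborel"
  then have S [measurable]: "S \<in> sets borel" by simp
  have S': "(*v) A -` S \<in> sets borel"
    using measurable_sets[OF measurable_matrix_vmul S, of A] by simp
  have "emeasure lborel S = ennreal \<bar>det A\<bar> * emeasure lborel ((*v) A -` S)"
    by (subst A) (simp add: emeasure_density_const emeasure_distr)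
  also have "emeasure lborel ((*v) A -` S) = ennreal \<bar>det B\<bar> * emeasure lborel ((*v) B -` (*v) A -` S)"
    using S' by (subst B) (simp add: emeasure_density_const emeasure_distr)
  also have "(*v) B -` (*v) A -` S = (*v) (A ** B) -` S"
    by (auto simp: matrix_vector_mul_assoc)
  finally show "emeasure lborel S
      = emeasure (density (distr lborel borel ((*v) (A ** B))) (\<lambda>_. ennreal \<bar>det (A ** B)\<bar>)) S"
    by (simp add: emeasure_density_const emeasure_distr det_mul abs_mult ennreal_mult mult.assoc)
qed simp

lemma density_distr_matrix_diagonal:
  fixes A :: "real ^ 'k ^ 'k"
  assumes diag: "\<And>i j. i \<noteq> j \<Longrightarrow> A $ i $ j = 0" and A: "invertible A"
  shows "lborel = density (distr lborel borel ((*v) A)) (\<lambda>_. ennreal \<bar>det A\<bar>)"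
proof -
  have det: "det A = (\<Prod>i\<in>UNIV. A $ i $ i)" by (rule det_diagonal[OF diag])
  \<comment> \<open>The scaling factors have to be indexed by basis vectors instead of coordinates;
    \<open>c\<close> reads the i-th diagonal entry off the i-th basis vector.\<close>
  define c :: "real ^ 'k \<Rightarrow> real" where "c b = b \<bullet> (A *v b)" for b
  have c: "c (axis i 1) = A $ i $ i" for i
    by (simp add: c_def inner_axis' matrix_vector_mult_basis column_def)
  have nz: "A $ i $ i \<noteq> 0" for i
    using A det by (simp add: invertible_det_nz)
  have Av: "A *v x = 0 + (\<Sum>j\<in>Basis. (c j * (x \<bullet> j)) *\<^sub>R j)" for x
  proof -
    have "(\<Sum>j\<in>Basis. (c j * (x \<bullet> j)) *\<^sub>R j) = (\<Sum>i\<in>UNIV. (A $ i $ i * x $ i) *\<^sub>R axis i 1)"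
      unfolding Basis_vec_eq_range_axis
      by (subst sum.reindex) (auto simp: inj_on_def axis_eq_axis c inner_axis)
    also have "\<dots> = A *v x"
    proof (rule vec_eq_iff[THEN iffD2], rule allI)
      fix r
      have "(A *v x) $ r = (\<Sum>j\<in>UNIV. if j = r then A $ r $ r * x $ r else 0)"
        using diag by (simp only: matrix_vector_mult_def vec_lambda_beta) (rule sum.cong, auto)
      then show "(\<Sum>i\<in>UNIV. (A $ i $ i * x $ i) *\<^sub>R axis i 1) $ r = (A *v x) $ r"
        by (simp add: axis_def if_distrib cong: if_cong)
    qed
    finally show ?thesis by simp
  qed
  have "lborel = density (distr lborel borel (\<lambda>x. 0 + (\<Sum>j\<in>Basis. (c j * (x \<bullet> j)) *\<^sub>R j)))
      (\<lambda>_. (\<Prod>j\<in>Basis. \<bar>c j\<bar>))"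
    by (rule lborel_affine_euclidean[of c 0]) (auto simp: Basis_vec_eq_range_axis c nz)
  then show ?thesis
    unfolding Av[symmetric] by (simp add: prod_Basis_vec c det abs_prod)
qed

lemma matrix_vmul_swap:
  fixes x :: "real ^ 'k"
  shows "(\<chi> i j. mat 1 $ i $ Transposition.transpose m n j) *v x = (\<chi> i. x $ Transposition.transpose m n i)"
proof (rule vec_eq_iff[THEN iffD2], rule allI)
  fix i
  have "((\<chi> i j. mat 1 $ i $ Transposition.transpose m n j) *v x) $ i
      = (\<Sum>j\<in>UNIV. if j = Transposition.transpose m n i then x $ j else 0)"
    by (simp only: matrix_vector_mult_def mat_def vec_lambda_beta)
       (rule sum.cong, auto)
  then show "((\<chi> i j. mat 1 $ i $ Transposition.transpose m n j) *v x) $ i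
      = (\<chi> i. x $ Transposition.transpose m n i) $ i"
    by simp
qed

text \<open>The preimage of a box is the box with two pairs of bounds exchanged, because a
  transposition is its own inverse. The volume is then the same product in another order.\<close>

lemma density_distr_matrix_swap:
  fixes m n :: "'k::finite"
  defines "A \<equiv> (\<chi> i j. mat 1 $ i $ Transposition.transpose m n j) :: real ^ 'k ^ 'k"
  shows "lborel = density (distr lborel borel ((*v) A)) (\<lambda>_. ennreal \<bar>det A\<bar>)"
proof -
  let ?t = "Transposition.transpose m n"
  have t: "?t permutes UNIV" by (simp add: permutes_swap_id)
  have "det A = of_int (sign ?t) * det (mat 1 :: real ^ 'k ^ 'k)"
    unfolding A_def by (rule det_permute_columns[OF t])
  then have det: "\<bar>det A\<bar> = 1" by (simp add: sign_def)
  have "lborel = distr lborel borel ((*v) A)"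
  proof (rule lborel_eqI)
    fix l u :: "real ^ 'k"
    assume "\<And>b. b \<in> Basis \<Longrightarrow> l \<bullet> b \<le> u \<bullet> b"
    then have le: "l $ r \<le> u $ r" for r
      by (metis Basis_vec_eq_range_axis cart_eq_inner_axis rangeI)
    have "(*v) A -` box l u = box (\<chi> i. l $ ?t i) (\<chi> i. u $ ?t i)"
      unfolding A_def by (auto simp: matrix_vmul_swap mem_box_cart) (metis transpose_involutory)+
    then have "emeasure (distr lborel borel ((*v) A)) (box l u)
        = ennreal (\<Prod>i\<in>UNIV. u $ ?t i - l $ ?t i)"
      using le by (simp add: emeasure_distr emeasure_lborel_box_vec)
    also have "(\<Prod>i\<in>UNIV. u $ ?t i - l $ ?t i) = (\<Prod>i\<in>UNIV. u $ i - l $ i)"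
      using prod.permute[OF t, of "\<lambda>i. u $ i - l $ i"] by (simp add: o_def)
    finally show "emeasure (distr lborel borel ((*v) A)) (box l u) = (\<Prod>b\<in>Basis. (u - l) \<bullet> b)"
      by (simp add: prod_Basis_vec inner_axis)
  qed simp
  then show ?thesis by (simp add: det density_1)
qed

text \<open>Once all coordinates other than the one along \<open>a\<close> are fixed, the shear only
  translates that coordinate by a constant, as \<open>a\<close> and \<open>b\<close> are different.
  Translation invariance on the line finishes the argument.\<close>

lemma nn_integral_lborel_shear:
  fixes a b :: "'a::euclidean_space" and f :: "'a \<Rightarrow> ennreal"
  assumes ab: "a \<in> Basis" "b \<in> Basis" "a \<noteq> b" and f [measurable]: "f \<in> borel_measurable borel"
  shows "(\<integral>\<^sup>+x. f (x + (x \<bullet> b) *\<^sub>R a) \<partial>lborel) = (\<integral>\<^sup>+x. f x \<partial>lborel)"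
proof -
  interpret product_sigma_finite "\<lambda>_ :: 'a. lborel :: real measure" ..
  define I where "I = Basis - {a}"
  have I: "finite I" "a \<notin> I" "insert a I = Basis" "b \<in> I" using ab by (auto simp: I_def)
  let ?L = "\<lambda>w :: 'a \<Rightarrow> real. \<Sum>c\<in>Basis. w c *\<^sub>R c"
  \<comment> \<open>Fubini with the coordinate \<open>y\<close> along \<open>a\<close> innermost;
    \<open>w\<close> carries the remaining coordinates.\<close>
  have split: "(\<integral>\<^sup>+x. g x \<partial>lborel)
      = (\<integral>\<^sup>+w. (\<integral>\<^sup>+y. g ((\<Sum>c\<in>I. w c *\<^sub>R c) + y *\<^sub>R a) \<partial>lborel) \<partial>(\<Pi>\<^sub>M c\<in>I. lborel))"
    if [measurable]: "g \<in> borel_measurable borel" for g :: "'a \<Rightarrow> ennreal"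
  proof -
    have L: "?L (w(a := y)) = (\<Sum>c\<in>I. w c *\<^sub>R c) + y *\<^sub>R a" for w y
    proof -
      have "?L (w(a := y)) = y *\<^sub>R a + (\<Sum>c\<in>I. (w(a := y)) c *\<^sub>R c)"
        unfolding I(3)[symmetric] using I(1,2) by (subst sum.insert) auto
      also have "(\<Sum>c\<in>I. (w(a := y)) c *\<^sub>R c) = (\<Sum>c\<in>I. w c *\<^sub>R c)"
        using I by (intro sum.cong) auto
      finally show ?thesis by simp
    qed
    have "(\<integral>\<^sup>+x. g x \<partial>lborel) = (\<integral>\<^sup>+w. g (?L w) \<partial>(\<Pi>\<^sub>M c\<in>insert a I. lborel))"
      unfolding I(3) by (subst lborel_eq, subst nn_integral_distr) auto
    also have "\<dots> = (\<integral>\<^sup>+w. (\<integral>\<^sup>+y. g (?L (w(a := y))) \<partial>lborel) \<partial>(\<Pi>\<^sub>M c\<in>I. lborel))"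
      using I by (intro product_nn_integral_insert) auto
    finally show ?thesis unfolding L .
  qed
  have "(\<integral>\<^sup>+x. f (x + (x \<bullet> b) *\<^sub>R a) \<partial>lborel)
      = (\<integral>\<^sup>+w. (\<integral>\<^sup>+y. f ((\<Sum>c\<in>I. w c *\<^sub>R c) + (w b + y) *\<^sub>R a) \<partial>lborel) \<partial>(\<Pi>\<^sub>M c\<in>I. lborel))"
  proof (subst split, measurable, intro nn_integral_cong)
    fix w :: "'a \<Rightarrow> real" and y :: real
    have "(\<Sum>c\<in>I. w c *\<^sub>R c) \<bullet> b = (\<Sum>c\<in>I. if c = b then w b else 0)"
      unfolding inner_sum_left using ab by (intro sum.cong) (auto simp: I_def inner_Basis)
    then have "((\<Sum>c\<in>I. w c *\<^sub>R c) + y *\<^sub>R a) \<bullet> b = w b"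
      using I ab by (simp add: inner_add_left inner_Basis)
    then show "f ((\<Sum>c\<in>I. w c *\<^sub>R c) + y *\<^sub>R a + (((\<Sum>c\<in>I. w c *\<^sub>R c) + y *\<^sub>R a) \<bullet> b) *\<^sub>R a)
        = f ((\<Sum>c\<in>I. w c *\<^sub>R c) + (w b + y) *\<^sub>R a)"
      by (simp add: algebra_simps)
  qed
  also have "\<dots> = (\<integral>\<^sup>+w. (\<integral>\<^sup>+y. f ((\<Sum>c\<in>I. w c *\<^sub>R c) + y *\<^sub>R a) \<partial>lborel) \<partial>(\<Pi>\<^sub>M c\<in>I. lborel))"
  proof (rule nn_integral_cong)
    fix w :: "'a \<Rightarrow> real"
    show "(\<integral>\<^sup>+y. f ((\<Sum>c\<in>I. w c *\<^sub>R c) + (w b + y) *\<^sub>R a) \<partial>lborel)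
        = (\<integral>\<^sup>+y. f ((\<Sum>c\<in>I. w c *\<^sub>R c) + y *\<^sub>R a) \<partial>lborel)"
      by (subst (2) lborel_distr_plus[symmetric, of "w b"], subst nn_integral_distr) auto
  qed
  also have "\<dots> = (\<integral>\<^sup>+x. f x \<partial>lborel)"
    by (rule split[symmetric]) fact
  finally show ?thesis .
qed

lemma density_distr_matrix_shear:
  fixes m n :: "'k::finite"
  assumes mn: "m \<noteq> n"
  defines "A \<equiv> (\<chi> i j. of_bool (i = m \<and> j = n \<or> i = j)) :: real ^ 'k ^ 'k"
  shows "lborel = density (distr lborel borel ((*v) A)) (\<lambda>_. ennreal \<bar>det A\<bar>)"
proof -
  have "A = (\<chi> k. if k = m then row m (mat 1) + 1 *s row n (mat 1) else row k (mat 1))"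
    using mn by (auto simp: A_def vec_eq_iff row_def mat_def)
  then have det: "det A = 1"
    using det_row_operation[OF mn, of "mat 1 :: real ^ 'k ^ 'k" 1] by simp
  have Av: "A *v x = x + (x \<bullet> axis n 1) *\<^sub>R axis m 1" for x
  proof (rule vec_eq_iff[THEN iffD2], rule allI)
    fix i
    have "(A *v x) $ i = (\<Sum>j\<in>UNIV. (if j = i then x $ i else 0) + (if j = n then of_bool (i = m) * x $ n else 0))"
      using mn by (simp only: matrix_vector_mult_def A_def vec_lambda_beta) (rule sum.cong, auto)
    then show "(A *v x) $ i = (x + (x \<bullet> axis n 1) *\<^sub>R axis m 1) $ i"
      by (simp add: sum.distrib inner_axis) (simp add: axis_def)
  qed
  have "lborel = distr lborel borel ((*v) A)"
  proof (rule measure_eqI)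
    fix S :: "(real ^ 'k) set"
    assume "S \<in> sets lborel"
    then have S [measurable]: "S \<in> sets borel" by simp
    have "emeasure lborel S = (\<integral>\<^sup>+x. indicator S x \<partial>lborel)" by simp
    also have "\<dots> = (\<integral>\<^sup>+x. indicator S (A *v x) \<partial>lborel)"
      unfolding Av using mn
      by (intro nn_integral_lborel_shear[symmetric]) (auto simp: Basis_vec_eq_range_axis axis_eq_axis)
    also have "\<dots> = (\<integral>\<^sup>+x. indicator S x \<partial>distr lborel borel ((*v) A))"
      by (subst nn_integral_distr) auto
    finally show "emeasure lborel S = emeasure (distr lborel borel ((*v) A)) S" by simp
  qed simp
  then show ?thesis by (simp add: det density_1)
qed

lemma lborel_eq_density_distr_matrix:
  fixes A :: "real ^ 'k ^ 'k"
  assumes "invertible A"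
  shows "lborel = density (distr lborel borel ((*v) A)) (\<lambda>_. ennreal \<bar>det A\<bar>)"
proof -
  \<comment> \<open>The induction also passes through singular matrices. The guard makes the case of
    a zero row vacuous, and in the product case it is inherited by both factors.\<close>
  have "det A \<noteq> 0 \<longrightarrow> lborel = density (distr lborel borel ((*v) A)) (\<lambda>_. ennreal \<bar>det A\<bar>)"
  proof (induction A rule: induct_matrix_elementary_alt)
    case (1 A B)
    then show ?case
      using density_distr_matrix_mult[of A B] by (simp add: det_mul)
  next
    case (2 A i)
    then show ?case using det_zero_row(1)[of i A] by simp
  next
    case (3 A)
    then show ?case using density_distr_matrix_diagonal[of A] by (auto simp: invertible_det_nz)
  next
    case (4 m n)
    then show ?case using density_distr_matrix_swap by blast
  next
    case (5 m n)
    then show ?case using density_distr_matrix_shear by blast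
  qed
  then show ?thesis using assms by (simp add: invertible_det_nz)
qed

lemma emeasure_lborel_vimage_matrix:
  fixes A :: "real ^ 'k ^ 'k"
  assumes "invertible A" "S \<in> sets borel"
  shows "emeasure lborel S = ennreal \<bar>det A\<bar> * emeasure lborel ((*v) A -` S)"
  using assms
  by (subst lborel_eq_density_distr_matrix[of A]) (auto simp: emeasure_density_const emeasure_distr)

lemma integral_lborel_matrix_image:
  fixes A :: "real ^ 'k ^ 'k" and f :: "real ^ 'k \<Rightarrow> 'b::{banach, second_countable_topology}"
  assumes A: "invertible A" and f [measurable]: "f \<in> borel_measurable borel"
  shows "(\<integral>x. f x \<partial>lborel) = \<bar>det A\<bar> *\<^sub>R (\<integral>x. f (A *v x) \<partial>lborel)"
proof -
  show ?thesis
    by (subst lborel_eq_density_distr_matrix[OF A]) (simp add: integral_density integral_distr)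
qed

subsection \<open>Exponentials on the cube\<close>

text \<open>With c = \<i> pi n, the antiderivative exp(c t) / c agrees at 1 and -1, because 2c is an
  integer multiple of 2 pi \<i>. The hypothesis that n is nonzero permits the division by c.\<close>

lemma integral_exp_pi_int:
  assumes "n \<in> \<int>" "n \<noteq> 0"
  shows "(\<integral>t. indicator {-1..1} t *\<^sub>R exp (\<i> * complex_of_real (pi * n * t)) \<partial>lborel) = 0"
proof -
  define c where "c = \<i> * complex_of_real (pi * n)"
  have c: "c \<noteq> 0" using assms by (simp add: c_def)
  let ?F = "\<lambda>t. exp (c * complex_of_real t) / c"
  have "(\<integral>t. indicator {-1..1} t *\<^sub>R exp (c * complex_of_real t) \<partial>lborel) = ?F 1 - ?F (-1)"
  proof (rule integral_FTC_atLeastAtMost)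
    fix t :: real
    have "((\<lambda>z. exp (c * z) / c) has_field_derivative exp (c * of_real t)) (at (of_real t))"
      using c by (auto intro!: derivative_eq_intros)
    then show "(?F has_vector_derivative exp (c * complex_of_real t)) (at t within {-1..1})"
      by (rule has_vector_derivative_real_field)
  qed (auto intro!: continuous_intros)
  moreover have "exp c = exp (- c)"
  proof -
    obtain z :: int where "n = of_int z" using assms by (auto elim: Ints_cases)
    then have "c = - c + of_int (2 * z) * complex_of_real pi * \<i>"
      by (simp add: c_def)
    then show ?thesis
      unfolding exp_eq by (metis (no_types, lifting) mult.assoc mult.commute of_int_mult of_int_numeral of_real_mult of_real_numeral of_real_of_int_eq)
  qed
  ultimately show ?thesis by (simp add: c_def mult_ac)
qed

lemma integral_lborel_prod:
  fixes f :: "'a::euclidean_space \<Rightarrow> real \<Rightarrow> complex"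
  assumes "\<And>b. b \<in> Basis \<Longrightarrow> integrable lborel (f b)"
  shows "(\<integral>x. (\<Prod>b\<in>Basis. f b (x \<bullet> b)) \<partial>lborel) = (\<Prod>b\<in>(Basis :: 'a set). \<integral>t. f b t \<partial>lborel)"
proof -
  interpret product_sigma_finite "\<lambda>_ :: 'a. lborel :: real measure" ..
  have [measurable]: "f b \<in> borel_measurable borel" if "b \<in> Basis" for b
    using borel_measurable_integrable[OF assms[OF that]] by simp
  have "(\<integral>x. (\<Prod>b\<in>Basis. f b (x \<bullet> b)) \<partial>lborel)
      = (\<integral>x. (\<Prod>b\<in>Basis. f b (x b)) \<partial>(\<Pi>\<^sub>M b\<in>(Basis :: 'a set). lborel))"
    by (subst lborel_eq, subst integral_distr)
       (auto simp: inner_sum_left inner_Basis if_distrib cong: if_cong prod.cong)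
  also have "\<dots> = (\<Prod>b\<in>(Basis :: 'a set). \<integral>t. f b t \<partial>lborel)"
    using assms by (intro product_integral_prod) auto
  finally show ?thesis .
qed

lemma continuous_on_exponential: "continuous_on S (exponential l)"
  unfolding exponential_def by (intro continuous_intros)

lemma measurable_exponential [measurable]: "exponential l \<in> borel_measurable borel"
  by (intro borel_measurable_continuous_onI continuous_on_exponential)

lemma std_cube_eq_cbox: "std_cube = cbox (- 1) (1 :: real ^ 'k)"
  by (auto simp: std_cube_def mem_box_cart)

text \<open>The indicator of the cube and the exponential both split into one factor per coordinate.
  A coordinate \<open>p\<close> in which \<open>k\<close> does not vanish contributes a zero
  factor.\<close>

lemma integral_exponential_std_cube:
  fixes k :: "real ^ 'k"
  assumes k: "k \<in> int_vecs" "k \<noteq> 0"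
  shows "(\<integral>v. indicator std_cube v *\<^sub>R exponential (pi *\<^sub>R k) v \<partial>lborel) = 0"
proof -
  let ?f = "\<lambda>(b :: real ^ 'k) t. indicator {-1..1} t *\<^sub>R exp (\<i> * complex_of_real (pi * (k \<bullet> b) * t))"
  obtain p where p: "k $ p \<noteq> 0" using k(2) by (auto simp: vec_eq_iff)
  have "(\<integral>v. indicator std_cube v *\<^sub>R exponential (pi *\<^sub>R k) v \<partial>lborel)
      = (\<integral>v. (\<Prod>b\<in>Basis. ?f b (v \<bullet> b)) \<partial>lborel)"
  proof (rule Bochner_Integration.integral_cong[OF refl])
    fix v :: "real ^ 'k"
    have "exponential (pi *\<^sub>R k) v = (\<Prod>b\<in>Basis. exp (\<i> * complex_of_real (pi * (k \<bullet> b) * (v \<bullet> b))))"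
      by (simp add: exponential_def exp_sum[symmetric] sum_distrib_left mult.assoc
            euclidean_inner[of k v])
    moreover have "(indicator std_cube v :: real) = (\<Prod>b\<in>Basis. indicator {-1..1} (v \<bullet> b))"
    proof (cases "v \<in> std_cube")
      case True
      then show ?thesis
        by (simp add: prod_Basis_vec std_cube_def inner_axis)
    next
      case False
      then obtain i where "v $ i \<notin> {-1..1}" by (auto simp: std_cube_def)
      then have "(\<Prod>i\<in>UNIV. indicator {-1..1} (v $ i) :: real) = 0"
        by (intro prod_zero) (auto intro!: exI[of _ i])
      then show ?thesis using False
        by (simp add: prod_Basis_vec inner_axis)
    qed
    ultimately show "indicator std_cube v *\<^sub>R exponential (pi *\<^sub>R k) v = (\<Prod>b\<in>Basis. ?f b (v \<bullet> b))"
      by (simp add: scaleR_conv_of_real prod.distrib)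
  qed
  also have "\<dots> = (\<Prod>b\<in>(Basis :: (real ^ 'k) set). \<integral>t. ?f b t \<partial>lborel)"
    by (intro integral_lborel_prod borel_integrable_compact) (auto intro!: continuous_intros)
  also have "\<dots> = 0"
  proof (rule prod_zero)
    show "\<exists>b\<in>(Basis :: (real ^ 'k) set). (\<integral>t. ?f b t \<partial>lborel) = 0"
    proof
      show "(\<integral>t. ?f (axis p 1) t \<partial>lborel) = 0"
        using k p by (intro integral_exp_pi_int) (auto simp: inner_axis int_vecs_def)
    qed (simp add: Basis_vec_eq_range_axis)
  qed simp
  finally show ?thesis .
qed

subsection \<open>Density of lattices\<close>

lemma sets_half_open_cube [measurable]: "half_open_cube (x :: real ^ 'k) \<rho> \<in> sets borel"
proof -
  have "half_open_cube x \<rho> = (\<Inter>i. {y. x $ i \<le> y $ i} \<inter> {y. y $ i < x $ i + \<rho>})"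
    by (auto simp: half_open_cube_def)
  also have "\<dots> \<in> sets borel"
    by (intro sets.finite_INT sets.Int borel_closed borel_open closed_Collect_le open_Collect_less continuous_intros) auto
  finally show ?thesis .
qed

text \<open>The half-open cube lies between an open and a closed box of the same volume.\<close>

lemma emeasure_half_open_cube:
  fixes x :: "real ^ 'k"
  assumes "0 \<le> \<rho>"
  shows "emeasure lborel (half_open_cube x \<rho>) = ennreal (\<rho> ^ CARD('k))"
proof (rule antisym)
  let ?y = "\<chi> i. x $ i + \<rho>"
  have box: "emeasure lborel (box x ?y) = ennreal (\<rho> ^ CARD('k))"
    using assms by (subst emeasure_lborel_box_vec) auto
  have "emeasure lborel (cbox x ?y) = emeasure lborel (box x ?y)"
    by (simp add: emeasure_lborel_cbox_eq emeasure_lborel_box_eq)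
  moreover have "emeasure lborel (half_open_cube x \<rho>) \<le> emeasure lborel (cbox x ?y)"
    by (intro emeasure_mono) (auto simp: half_open_cube_def mem_box_cart less_imp_le)
  ultimately show "emeasure lborel (half_open_cube x \<rho>) \<le> ennreal (\<rho> ^ CARD('k))"
    using box by simp
  show "ennreal (\<rho> ^ CARD('k)) \<le> emeasure lborel (half_open_cube x \<rho>)"
    unfolding box[symmetric]
    by (intro emeasure_mono) (auto simp: half_open_cube_def mem_box_cart less_imp_le)
qed

lemma bounded_half_open_cube: "bounded (half_open_cube (x :: real ^ 'k) \<rho>)"
  by (rule bounded_subset[OF bounded_cbox[of x "\<chi> i. x $ i + \<rho>"]])
     (auto simp: half_open_cube_def mem_box_cart less_imp_le)

section \<open>Integer points and integer parts\<close>

lemma int_vecs_add: "a \<in> int_vecs \<Longrightarrow> b \<in> int_vecs \<Longrightarrow> a + b \<in> int_vecs"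
  and int_vecs_diff: "a \<in> int_vecs \<Longrightarrow> b \<in> int_vecs \<Longrightarrow> a - b \<in> int_vecs"
  by (auto simp: int_vecs_def)

lemma infinite_int_vecs: "infinite (int_vecs :: (real ^ 'k) set)"
proof
  assume "finite (int_vecs :: (real ^ 'k) set)"
  then have "finite (range (\<lambda>n :: nat. (\<chi> i. real n) :: real ^ 'k))"
    by (rule rev_finite_subset) (auto simp: int_vecs_def)
  moreover have "inj (\<lambda>n :: nat. (\<chi> i. real n) :: real ^ 'k)"
    by (auto simp: inj_def vec_eq_iff)
  ultimately show False
    by (metis finite_imageD infinite_UNIV_nat)
qed

lemma finite_int_vecs_Int_bounded:
  fixes S :: "(real ^ 'k) set"
  assumes "bounded S"
  shows "finite (int_vecs \<inter> S)"
proof -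
  obtain N where N: "\<And>x. x \<in> S \<Longrightarrow> norm x \<le> N"
    using assms by (auto simp: bounded_iff)
  let ?X = "real_of_int ` {- \<lceil>N\<rceil> .. \<lceil>N\<rceil>}"
  have "int_vecs \<inter> S \<subseteq> vec_lambda ` (PiE UNIV (\<lambda>_ :: 'k. ?X))"
  proof
    fix z assume z: "z \<in> int_vecs \<inter> S"
    have "z $ i \<in> ?X" for i
    proof -
      obtain t where t: "z $ i = of_int t" using z by (auto simp: int_vecs_def elim: Ints_cases)
      have "\<bar>z $ i\<bar> \<le> N" using z N component_le_norm_cart[of z i] by force
      then have "\<bar>of_int t :: real\<bar> \<le> of_int \<lceil>N\<rceil>" using t by linarith
      then have "\<bar>t\<bar> \<le> \<lceil>N\<rceil>" by linarith
      then show ?thesis using t by (intro image_eqI[of _ _ t]) auto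
    qed
    then show "z \<in> vec_lambda ` (PiE UNIV (\<lambda>_. ?X))"
      by (intro image_eqI[of _ _ "vec_nth z"]) (simp_all add: PiE_UNIV_domain)
  qed
  then show ?thesis
    by (rule finite_subset) (intro finite_imageI finite_PiE, auto)
qed

definition floor_vec :: "real ^ 'k \<Rightarrow> real ^ 'k"
  where "floor_vec v = (\<chi> i. of_int \<lfloor>v $ i\<rfloor>)"

lemma floor_vec_in_int_vecs: "floor_vec v \<in> int_vecs"
  by (simp add: floor_vec_def int_vecs_def)

lemma diff_floor_vec: "v - floor_vec v \<in> half_open_cube 0 1"
  unfolding floor_vec_def half_open_cube_def by (auto simp: algebra_simps) linarith

text \<open>Integer translates of [0,1)^k do not overlap. This gives both the disjointness of the
  unit cubes in the volume count and the uniqueness of coset representatives.\<close>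

lemma floor_vec_unique:
  assumes "z \<in> int_vecs" "w \<in> half_open_cube 0 1"
  shows "floor_vec (z + w) = z"
proof -
  have "of_int \<lfloor>z $ i + w $ i\<rfloor> = z $ i" for i
  proof -
    obtain t where "z $ i = of_int t" using assms(1) by (auto simp: int_vecs_def elim: Ints_cases)
    moreover have "0 \<le> w $ i" "w $ i < 1" using assms(2) by (auto simp: half_open_cube_def)
    ultimately show ?thesis by (simp add: floor_eq_iff)
  qed
  then show ?thesis by (simp add: floor_vec_def vec_eq_iff)
qed

lemma half_open_cube_translate: "v \<in> half_open_cube z \<rho> \<longleftrightarrow> v - z \<in> half_open_cube 0 \<rho>"
  by (auto simp: half_open_cube_def algebra_simps)

text \<open>The unit cubes based at the integer points \<open>z\<close> with \<open>G z\<close> in a cube \<open>Q\<close> fill the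
  \<open>G\<close>-preimage of \<open>Q\<close>, up to a boundary layer whose width depends only on \<open>G\<close>.\<close>

lemma card_lattice_Int_cube:
  fixes G :: "real ^ 'k ^ 'k" and x :: "real ^ 'k"
  assumes G: "invertible G"
    and c: "\<And>w i. w \<in> half_open_cube 0 1 \<Longrightarrow> \<bar>(G *v w) $ i\<bar> \<le> c"
    and \<rho>: "0 \<le> c" "2 * c \<le> \<rho>"
  defines "T \<equiv> {z \<in> int_vecs. G *v z \<in> half_open_cube x \<rho>}"
  shows "finite T"
    and "(\<rho> - 2 * c) ^ CARD('k) \<le> \<bar>det G\<bar> * real (card T)"
    and "\<bar>det G\<bar> * real (card T) \<le> (\<rho> + 2 * c) ^ CARD('k)"
proof -
  have "bounded ((*v) (matrix_inv G) ` half_open_cube x \<rho>)"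
    by (intro bounded_linear_image bounded_half_open_cube matrix_vector_mul_bounded_linear)
  moreover have "T \<subseteq> int_vecs \<inter> (*v) (matrix_inv G) ` half_open_cube x \<rho>"
    using G by (auto simp: T_def matrix_vector_mul_assoc matrix_inv_mult intro!: image_eqI[of _ _ "G *v z" for z])
  ultimately show fin: "finite T"
    using finite_int_vecs_Int_bounded finite_subset by blast
  \<comment> \<open>The cubes are disjoint and have volume 1, so the volume of \<open>E\<close> is
    the number of points in \<open>T\<close>. Both bounds on \<open>card T\<close> thereby become
    comparisons of volumes.\<close>
  define E where "E = (\<Union>z\<in>T. half_open_cube z 1)"
  have disj: "disjoint_family_on (\<lambda>z. half_open_cube z 1) T"
  proof (unfold disjoint_family_on_def, intro ballI impI)
    fix z z' assume zz: "z \<in> T" "z' \<in> T" "z \<noteq> z'"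
    show "half_open_cube z 1 \<inter> half_open_cube z' 1 = {}"
    proof (rule ccontr)
      assume "half_open_cube z 1 \<inter> half_open_cube z' 1 \<noteq> {}"
      then obtain v where "v - z \<in> half_open_cube 0 1" "v - z' \<in> half_open_cube 0 1"
        by (auto simp: half_open_cube_translate[symmetric])
      then have "z = z'"
        using floor_vec_unique[of z "v - z"] floor_vec_unique[of z' "v - z'"] zz by (simp add: T_def)
      with zz show False by simp
    qed
  qed
  have E [measurable]: "E \<in> sets borel"
    unfolding E_def using fin by (intro sets.finite_UN) auto
  have "emeasure lborel E = (\<Sum>z\<in>T. emeasure lborel (half_open_cube z 1))"
    unfolding E_def using fin disj by (intro sum_emeasure[symmetric]) auto
  also have "\<dots> = ennreal (real (card T))"
    by (simp add: emeasure_half_open_cube ennreal_of_nat_eq_real_of_nat)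
  finally have mE: "emeasure lborel E = ennreal (real (card T))" .
  \<comment> \<open>Moving the corner by \<open>b\<close> outwards or inwards enlarges or shrinks
    the cube by \<open>c\<close> on every side; hence the changes of side length by 2c
    below.\<close>
  define b :: "real ^ 'k" where "b = (\<chi> i. c)"
  have vG: "(*v) G -` half_open_cube y r \<in> sets borel" for y r
    using measurable_sets[OF measurable_matrix_vmul sets_half_open_cube, of G y r] by simp
  have "E \<subseteq> (*v) G -` half_open_cube (x - b) (\<rho> + 2 * c)"
  proof
    fix v assume "v \<in> E"
    then obtain z where z: "z \<in> T" "v - z \<in> half_open_cube 0 1"
      by (auto simp: E_def half_open_cube_translate[symmetric])
    have Gv: "G *v v = G *v z + G *v (v - z)" by (simp add: matrix_vector_right_distrib[symmetric])
    have "x $ i - c \<le> (G *v v) $ i \<and> (G *v v) $ i < x $ i + \<rho> + c" for i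
    proof -
      have "x $ i \<le> (G *v z) $ i \<and> (G *v z) $ i < x $ i + \<rho>"
        using z(1) by (simp add: T_def half_open_cube_def)
      then show ?thesis unfolding Gv using c[OF z(2), of i] by auto
    qed
    then show "v \<in> (*v) G -` half_open_cube (x - b) (\<rho> + 2 * c)"
      by (simp add: half_open_cube_def b_def algebra_simps)
  qed
  then have "emeasure lborel E \<le> emeasure lborel ((*v) G -` half_open_cube (x - b) (\<rho> + 2 * c))"
    using vG by (intro emeasure_mono) auto
  then have "ennreal \<bar>det G\<bar> * emeasure lborel E \<le> emeasure lborel (half_open_cube (x - b) (\<rho> + 2 * c))"
    by (subst emeasure_lborel_vimage_matrix[OF G sets_half_open_cube]) (rule mult_left_mono, auto)
  also have "\<dots> = ennreal ((\<rho> + 2 * c) ^ CARD('k))"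
    using \<rho> by (intro emeasure_half_open_cube) simp
  finally show "\<bar>det G\<bar> * real (card T) \<le> (\<rho> + 2 * c) ^ CARD('k)"
    using \<rho> by (simp add: mE ennreal_mult[symmetric] ennreal_le_iff)
  have "(*v) G -` half_open_cube (x + b) (\<rho> - 2 * c) \<subseteq> E"
  proof
    fix v assume v: "v \<in> (*v) G -` half_open_cube (x + b) (\<rho> - 2 * c)"
    define z where "z = floor_vec v"
    have z: "z \<in> int_vecs" "v - z \<in> half_open_cube 0 1"
      by (auto simp: z_def floor_vec_in_int_vecs diff_floor_vec)
    have Gz: "G *v z = G *v v - G *v (v - z)" by (simp add: matrix_vector_mult_diff_distrib)
    have "x $ i \<le> (G *v z) $ i \<and> (G *v z) $ i < x $ i + \<rho>" for i
    proof -
      have "x $ i + c \<le> (G *v v) $ i \<and> (G *v v) $ i < x $ i + c + (\<rho> - 2 * c)"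
        using v by (simp add: b_def half_open_cube_def)
      then show ?thesis unfolding Gz using c[OF z(2), of i] by auto
    qed
    then have "G *v z \<in> half_open_cube x \<rho>"
      by (simp add: half_open_cube_def)
    then show "v \<in> E"
      using z by (auto simp: E_def T_def half_open_cube_translate[of v])
  qed
  then have "emeasure lborel ((*v) G -` half_open_cube (x + b) (\<rho> - 2 * c)) \<le> emeasure lborel E"
    by (intro emeasure_mono) auto
  then have "emeasure lborel (half_open_cube (x + b) (\<rho> - 2 * c)) \<le> ennreal \<bar>det G\<bar> * emeasure lborel E"
    by (subst emeasure_lborel_vimage_matrix[OF G sets_half_open_cube]) (rule mult_left_mono, auto)
  moreover have "emeasure lborel (half_open_cube (x + b) (\<rho> - 2 * c)) = ennreal ((\<rho> - 2 * c) ^ CARD('k))"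
    using \<rho> by (intro emeasure_half_open_cube) simp
  ultimately show "(\<rho> - 2 * c) ^ CARD('k) \<le> \<bar>det G\<bar> * real (card T)"
    by (simp add: mE ennreal_mult[symmetric] ennreal_le_iff)
qed

section \<open>From counting bounds to densities\<close>

text \<open>The bounds are uniform in the corner \<open>x\<close>, so they pass to the infimum and
  the supremum. After division by the volume they become D (1 - 2c/\<rho>)^N and D (1 +
  2c/\<rho>)^N, with N the dimension, and both tend to D.\<close>

lemma has_density_sandwich:
  fixes L :: "(real ^ 'k) set"
  assumes c: "0 \<le> c" and D: "0 \<le> D"
    and fin: "\<And>x \<rho>. finite (L \<inter> half_open_cube x \<rho>)"
    and lo: "\<And>x \<rho>. 2 * c \<le> \<rho> \<Longrightarrow> D * (\<rho> - 2 * c) ^ CARD('k) \<le> real (card (L \<inter> half_open_cube x \<rho>))"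
    and hi: "\<And>x \<rho>. 2 * c \<le> \<rho> \<Longrightarrow> real (card (L \<inter> half_open_cube x \<rho>)) \<le> D * (\<rho> + 2 * c) ^ CARD('k)"
  shows "has_density L D"
proof -
  let ?N = "CARD('k)"
  let ?lo = "\<lambda>\<rho>. ennreal (D * (\<rho> - 2 * c) ^ ?N / \<rho> ^ ?N)"
  let ?hi = "\<lambda>\<rho>. ennreal (D * (\<rho> + 2 * c) ^ ?N / \<rho> ^ ?N)"
  have em: "emeasure (count_space UNIV) (L \<inter> half_open_cube x \<rho>)
      = ennreal (real (card (L \<inter> half_open_cube x \<rho>)))" for x \<rho>
    using fin by (simp add: emeasure_count_space_finite ennreal_of_nat_eq_real_of_nat)
  have ev: "\<forall>\<^sub>F \<rho> in at_top. 2 * c \<le> \<rho> \<and> 0 < \<rho>"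
    by (intro eventually_conj eventually_ge_at_top eventually_gt_at_top)
  have lo': "?lo \<rho> \<le> min_count_ratio L \<rho>" if "2 * c \<le> \<rho> \<and> 0 < \<rho>" for \<rho>
  proof -
    have "ennreal (D * (\<rho> - 2 * c) ^ ?N)
        \<le> (INF x. emeasure (count_space UNIV) (L \<inter> half_open_cube x \<rho>))"
      using that lo by (intro INF_greatest) (simp add: em ennreal_leI)
    then have "ennreal (D * (\<rho> - 2 * c) ^ ?N) / ennreal (\<rho> ^ ?N) \<le> min_count_ratio L \<rho>"
      unfolding min_count_ratio_def by (rule divide_right_mono_ennreal)
    then show ?thesis using that D by (simp add: divide_ennreal)
  qed
  have hi': "max_count_ratio L \<rho> \<le> ?hi \<rho>" if "2 * c \<le> \<rho> \<and> 0 < \<rho>" for \<rho>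
  proof -
    have "(SUP x. emeasure (count_space UNIV) (L \<inter> half_open_cube x \<rho>))
        \<le> ennreal (D * (\<rho> + 2 * c) ^ ?N)"
      using that hi by (intro SUP_least) (simp add: em ennreal_leI)
    then have "max_count_ratio L \<rho> \<le> ennreal (D * (\<rho> + 2 * c) ^ ?N) / ennreal (\<rho> ^ ?N)"
      unfolding max_count_ratio_def by (rule divide_right_mono_ennreal)
    then show ?thesis using that D c by (simp add: divide_ennreal)
  qed
  have mm: "min_count_ratio L \<rho> \<le> max_count_ratio L \<rho>" for \<rho>
    unfolding min_count_ratio_def max_count_ratio_def
    by (intro divide_right_mono_ennreal INF_le_SUP) simp
  have lim: "((\<lambda>\<rho>. ennreal (D * (\<rho> + a) ^ ?N / \<rho> ^ ?N)) \<longlongrightarrow> ennreal D) at_top" for a :: real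
  proof (rule tendsto_ennrealI)
    have "((\<lambda>\<rho>. D * (1 + a / \<rho>) ^ ?N) \<longlongrightarrow> D * (1 + 0) ^ ?N) at_top"
      by (intro tendsto_intros tendsto_divide_0[OF tendsto_const] filterlim_at_top_imp_at_infinity filterlim_ident)
    moreover have "\<forall>\<^sub>F \<rho> in at_top. D * (1 + a / \<rho>) ^ ?N = D * (\<rho> + a) ^ ?N / \<rho> ^ ?N"
      using eventually_gt_at_top[of 0]
      by eventually_elim (simp add: power_divide[symmetric] add_divide_distrib flip: times_divide_eq_right)
    ultimately show "((\<lambda>\<rho>. D * (\<rho> + a) ^ ?N / \<rho> ^ ?N) \<longlongrightarrow> D) at_top"
      by (simp add: tendsto_cong)
  qed
  have limlo: "(?lo \<longlongrightarrow> ennreal D) at_top" using lim[of "- (2 * c)"] by simp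
  have "(max_count_ratio L \<longlongrightarrow> ennreal D) at_top"
    by (rule tendsto_sandwich[OF _ _ limlo lim[of "2 * c"]])
       (use ev lo' hi' mm in \<open>auto elim!: eventually_mono intro: order_trans\<close>)
  moreover have "(min_count_ratio L \<longlongrightarrow> ennreal D) at_top"
    by (rule tendsto_sandwich[OF _ _ limlo lim[of "2 * c"]])
       (use ev lo' hi' mm in \<open>auto elim!: eventually_mono intro: order_trans\<close>)
  ultimately show ?thesis using D by (simp add: has_density_def)
qed

text \<open>\<open>L\<close> is the disjoint union of finitely many translates \<open>r + G \<int>\<^sup>k\<close>, one for each point
  \<open>r\<close> of \<open>L\<close> in the fundamental parallelepiped \<open>G [0,1)\<^sup>k\<close>.\<close>

lemma lattice_has_density:
  fixes G :: "real ^ 'k ^ 'k" and L :: "(real ^ 'k) set"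
  assumes G: "invertible G" and sub: "\<And>z. z \<in> int_vecs \<Longrightarrow> G *v z \<in> L"
    and add: "\<And>a b. a \<in> L \<Longrightarrow> b \<in> L \<Longrightarrow> a + b \<in> L"
    and diff: "\<And>a b. a \<in> L \<Longrightarrow> b \<in> L \<Longrightarrow> a - b \<in> L"
    and fin: "\<And>S. bounded S \<Longrightarrow> finite (L \<inter> S)"
  obtains \<delta> where "has_density L \<delta>" "1 / \<bar>det G\<bar> \<le> \<delta>"
proof -
  define R where "R = L \<inter> (*v) G ` half_open_cube 0 1"
  have bnd: "bounded ((*v) G ` half_open_cube 0 1)"
    by (intro bounded_linear_image bounded_half_open_cube matrix_vector_mul_bounded_linear)
  then have finR: "finite R" unfolding R_def by (rule fin)
  have "0 \<in> R"
  proof -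
    have "(0 :: real ^ 'k) \<in> half_open_cube 0 1" by (simp add: half_open_cube_def)
    moreover have "G *v 0 \<in> L" by (rule sub) (simp add: int_vecs_def)
    ultimately show ?thesis by (force simp: R_def)
  qed
  \<comment> \<open>The coset of 0 is always present; this is the source of the lower bound 1 / |det
    G| for the density.\<close>
  then have n1: "1 \<le> card R" using finR by (metis One_nat_def Suc_leI card_gt_0_iff empty_iff)
  obtain c0 where c0: "\<And>w. w \<in> half_open_cube 0 1 \<Longrightarrow> norm (G *v w) \<le> c0"
    using bnd by (auto simp: bounded_iff)
  define c where "c = \<bar>c0\<bar>"
  have c: "\<bar>(G *v w) $ i\<bar> \<le> c" if "w \<in> half_open_cube 0 1" for w i
    using c0[OF that] component_le_norm_cart[of "G *v w" i] by (simp add: c_def)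
  have c_pos: "0 \<le> c" by (simp add: c_def)
  have det: "0 < \<bar>det G\<bar>" using G by (simp add: invertible_det_nz)
  have inj: "z = z'" if "G *v z = G *v z'" for z z'
    using that G by (metis matrix_inv_mult(2) matrix_vector_mul_assoc matrix_vector_mul_lid)
  define T where "T x \<rho> = {z \<in> int_vecs. G *v z \<in> half_open_cube x \<rho>}" for x \<rho>
  have T: "finite (T x \<rho>)" "(\<rho> - 2 * c) ^ CARD('k) / \<bar>det G\<bar> \<le> real (card (T x \<rho>))"
    "real (card (T x \<rho>)) \<le> (\<rho> + 2 * c) ^ CARD('k) / \<bar>det G\<bar>" if "2 * c \<le> \<rho>" for x \<rho>
    using card_lattice_Int_cube[OF G c c_pos that, of x] det
    by (simp_all add: T_def pos_divide_le_eq pos_le_divide_eq mult.commute)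
  \<comment> \<open>A point r + G z lies in the cube at \<open>x\<close> exactly when G z lies in
    the cube at x - r. Each coset therefore contributes a lattice count in a shifted cube, to which
    the bounds uniform in the corner apply.\<close>
  have count: "card (L \<inter> half_open_cube x \<rho>) = (\<Sum>r\<in>R. card (T (x - r) \<rho>))" if "2 * c \<le> \<rho>" for x \<rho>
  proof -
    let ?f = "\<lambda>(r, z). r + G *v z"
    have mem: "r + G *v z \<in> half_open_cube x \<rho> \<longleftrightarrow> G *v z \<in> half_open_cube (x - r) \<rho>" for r z
      by (auto simp: half_open_cube_def algebra_simps)
    have "bij_betw ?f (SIGMA r:R. T (x - r) \<rho>) (L \<inter> half_open_cube x \<rho>)"
    proof (rule bij_betw_imageI)
      show "inj_on ?f (SIGMA r:R. T (x - r) \<rho>)"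
      proof (rule inj_onI, clarify)
        fix r z r' z'
        assume r: "r \<in> R" "r' \<in> R" and z: "z \<in> T (x - r) \<rho>" "z' \<in> T (x - r') \<rho>"
          and eq: "r + G *v z = r' + G *v z'"
        \<comment> \<open>Writing r = G w with w in [0,1)^k, the point r + G z equals G (z + w), and
          z is recovered as the integer part of z + w.\<close>
        obtain w w' where w: "r = G *v w" "w \<in> half_open_cube 0 1" "r' = G *v w'" "w' \<in> half_open_cube 0 1"
          using r by (auto simp: R_def)
        have "z + w = z' + w'"
          by (rule inj) (use eq w in \<open>simp add: matrix_vector_right_distrib add.commute\<close>)
        then have "z = z'"
          using floor_vec_unique[of z w] floor_vec_unique[of z' w'] w z by (simp add: T_def)
        with eq show "r = r' \<and> z = z'" by simp
      qed
      show "?f ` (SIGMA r:R. T (x - r) \<rho>) = L \<inter> half_open_cube x \<rho>"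
      proof (intro subset_antisym subsetI)
        fix l assume "l \<in> ?f ` (SIGMA r:R. T (x - r) \<rho>)"
        then show "l \<in> L \<inter> half_open_cube x \<rho>"
          using add sub by (auto simp: R_def T_def mem)
      next
        fix l assume l: "l \<in> L \<inter> half_open_cube x \<rho>"
        \<comment> \<open>The integer part \<open>z\<close> of the preimage of \<open>l\<close>
          selects the lattice vector G z. What is left lies in the fundamental parallelepiped, and
          in \<open>L\<close> because \<open>L\<close> is closed under differences.\<close>
        define v where "v = matrix_inv G *v l"
        define z where "z = floor_vec v"
        have Gv: "G *v v = l"
          using G by (simp add: v_def matrix_vector_mul_assoc matrix_inv_mult)
        have z: "z \<in> int_vecs" "v - z \<in> half_open_cube 0 1"
          by (auto simp: z_def floor_vec_in_int_vecs diff_floor_vec)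
        have lz: "l = G *v (v - z) + G *v z" by (simp add: Gv matrix_vector_right_distrib[symmetric])
        have "G *v (v - z) = l - G *v z" using lz by (simp add: algebra_simps)
        then have "G *v (v - z) \<in> R" using l z sub diff by (force simp: R_def)
        moreover have "z \<in> T (x - G *v (v - z)) \<rho>"
          using l z lz by (simp add: T_def mem[symmetric])
        ultimately show "l \<in> ?f ` (SIGMA r:R. T (x - r) \<rho>)"
          using lz by (intro image_eqI[of _ _ "(G *v (v - z), z)"]) auto
      qed
    qed
    then have "card (L \<inter> half_open_cube x \<rho>) = card (SIGMA r:R. T (x - r) \<rho>)"
      by (metis bij_betw_same_card)
    also have "\<dots> = (\<Sum>r\<in>R. card (T (x - r) \<rho>))"
      using finR T(1)[OF that] by (intro card_SigmaI) auto
    finally show ?thesis .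
  qed
  \<comment> \<open>There are \<open>card R\<close> cosets, each of density 1 / |det G|.\<close>
  let ?D = "real (card R) / \<bar>det G\<bar>"
  have "has_density L ?D"
  proof (rule has_density_sandwich[OF c_pos])
    fix x :: "real ^ 'k" and \<rho> :: real assume \<rho>: "2 * c \<le> \<rho>"
    have "(\<Sum>r\<in>R. (\<rho> - 2 * c) ^ CARD('k) / \<bar>det G\<bar>) \<le> (\<Sum>r\<in>R. real (card (T (x - r) \<rho>)))"
      by (intro sum_mono T \<rho>)
    then show "?D * (\<rho> - 2 * c) ^ CARD('k) \<le> real (card (L \<inter> half_open_cube x \<rho>))"
      by (simp add: count[OF \<rho>])
    have "(\<Sum>r\<in>R. real (card (T (x - r) \<rho>))) \<le> (\<Sum>r\<in>R. (\<rho> + 2 * c) ^ CARD('k) / \<bar>det G\<bar>)"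
      by (intro sum_mono T \<rho>)
    then show "real (card (L \<inter> half_open_cube x \<rho>)) \<le> ?D * (\<rho> + 2 * c) ^ CARD('k)"
      by (simp add: count[OF \<rho>])
  qed (auto intro: fin bounded_half_open_cube)
  moreover have "1 / \<bar>det G\<bar> \<le> ?D" using n1 det by (simp add: divide_right_mono)
  ultimately show ?thesis by (rule that)
qed

subsection \<open>The frequency lattice\<close>

lemma join_nth [simp]: "join x y $ Inl j = x $ j" "join x y $ Inr i = y $ i"
  by (simp_all add: join_def)

lemma vec_sum_eq_iff: "u = v \<longleftrightarrow> (\<forall>j. u $ Inl j = v $ Inl j) \<and> (\<forall>i. u $ Inr i = v $ Inr i)"
  unfolding vec_eq_iff by (metis sum.exhaust)

lemma sum_UNIV_sum:
  "(\<Sum>r\<in>(UNIV :: ('m::finite + 'n::finite) set). f r) = (\<Sum>j\<in>UNIV. f (Inl j)) + (\<Sum>i\<in>UNIV. f (Inr i))"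
  unfolding UNIV_sum
  by (subst sum.union_disjoint) (auto simp: sum.reindex)

lemma inner_join: "join x y \<bullet> join x' y' = x \<bullet> x' + y \<bullet> y'"
  by (simp add: inner_vec_def sum_UNIV_sum)

lemma invertible_ker:
  fixes A :: "real ^ 'k ^ 'k"
  assumes "\<And>x. A *v x = 0 \<Longrightarrow> x = 0"
  shows "invertible A"
  using assms by (metis invertible_left_inverse matrix_left_invertible_ker)

text \<open>Both determinants are read off from the volume of the preimage of a unit cube.\<close>

lemma abs_det_block:
  fixes B :: "real ^ ('m::finite + 'n::finite) ^ ('m + 'n)" and A :: "real ^ 'm ^ 'm"
  assumes A: "invertible A" and B: "\<And>x y. B *v join x y = join (A *v x) y"
  shows "\<bar>det B\<bar> = \<bar>det A\<bar>"
proof -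
  let ?Q = "half_open_cube 0 1 :: (real ^ ('m + 'n)) set"
  let ?Qm = "half_open_cube 0 1 :: (real ^ 'm) set"
  let ?Qn = "half_open_cube 0 1 :: (real ^ 'n) set"
  let ?J = "\<lambda>p. join (fst p) (snd p) :: real ^ ('m + 'n)"
  have invB: "invertible B"
  proof (rule invertible_ker)
    fix u assume u: "B *v u = 0"
    define x y where "x = (\<chi> j. u $ Inl j)" and "y = (\<chi> i. u $ Inr i)"
    have ju: "u = join x y" by (simp add: vec_sum_eq_iff x_def y_def)
    have "join (A *v x) y = 0" using u unfolding ju B .
    then have "A *v x = 0" "y = 0" by (auto simp: vec_eq_iff dest: spec[of _ "Inl j" for j] spec[of _ "Inr i" for i])
    then have "x = 0" "y = 0"
      using A by (metis matrix_inv_mult(2) matrix_vector_mul_assoc matrix_vector_mul_lid matrix_vector_mult_0_right)+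
    then show "u = 0" unfolding ju by (simp add: vec_sum_eq_iff)
  qed
  have vB: "(*v) B -` ?Q \<in> sets borel" and vA: "(*v) A -` ?Qm \<in> sets borel"
    using measurable_sets[OF measurable_matrix_vmul sets_half_open_cube, of B 0 1]
      measurable_sets[OF measurable_matrix_vmul sets_half_open_cube, of A 0 1] by auto
  have "?J -` ((*v) B -` ?Q) = ((*v) A -` ?Qm) \<times> ?Qn"
  proof -
    have "join a b \<in> ?Q \<longleftrightarrow> a \<in> ?Qm \<and> b \<in> ?Qn" for a b
      unfolding half_open_cube_def
      by (auto simp: join_def split: sum.split)
    then show ?thesis by (auto simp: B)
  qed
  then have "emeasure lborel ((*v) B -` ?Q) = emeasure (lborel \<Otimes>\<^sub>M lborel) (((*v) A -` ?Qm) \<times> ?Qn)"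
    using vB by (subst lborel_eq_distr_join) (simp add: emeasure_distr space_pair_measure)
  also have "\<dots> = emeasure lborel ((*v) A -` ?Qm) * emeasure lborel ?Qn"
    using vA by (intro lborel.emeasure_pair_measure_Times) auto
  finally have "emeasure lborel ((*v) B -` ?Q) = emeasure lborel ((*v) A -` ?Qm)"
    by (simp add: emeasure_half_open_cube)
  then have eq: "1 = ennreal \<bar>det B\<bar> * emeasure lborel ((*v) A -` ?Qm)"
    using emeasure_lborel_vimage_matrix[OF invB sets_half_open_cube, of 0 1]
    by (simp add: emeasure_half_open_cube)
  have eq': "1 = ennreal \<bar>det A\<bar> * emeasure lborel ((*v) A -` ?Qm)"
    using emeasure_lborel_vimage_matrix[OF A sets_half_open_cube, of 0 1]
    by (simp add: emeasure_half_open_cube)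
  \<comment> \<open>The common preimage volume is finite, since an infinite one times the nonzero
    |det A| could not be 1. It can then be cancelled as a real number.\<close>
  obtain e where e: "emeasure lborel ((*v) A -` ?Qm) = ennreal e" "0 \<le> e"
  proof (cases "emeasure lborel ((*v) A -` ?Qm)")
    case top
    with eq' show ?thesis using A by (simp add: ennreal_mult_top invertible_det_nz)
  qed auto
  have "\<bar>det B\<bar> * e = 1" "\<bar>det A\<bar> * e = 1"
    using eq eq' e by (simp_all add: ennreal_mult[symmetric] ennreal_1[symmetric] del: ennreal_1)
  then show ?thesis by (metis mult_right_cancel mult_zero_right zero_neq_one)
qed

lemma inner_matrix_axis:
  fixes A :: "real ^ 'k ^ 'l"
  shows "k \<bullet> (A *v axis r 1) = (k v* A) $ r"
  by (simp add: dot_lmul_matrix[symmetric] inner_axis)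

lemma vector_matrix_inv_mult:
  fixes M :: "real ^ 'k ^ 'k"
  assumes "invertible M"
  shows "x v* matrix_inv M v* M = x" and "x v* M v* matrix_inv M = x"
proof -
  have "x v* mat 1 = x" for x :: "real ^ 'k"
    by (metis transpose_mat transpose_matrix_vector matrix_vector_mul_lid)
  then show "x v* matrix_inv M v* M = x" and "x v* M v* matrix_inv M = x"
    using assms by (simp_all add: vector_matrix_mul_assoc matrix_inv_mult)
qed

section \<open>Frequencies as integer vectors\<close>

text \<open>The only vector that can produce the frequency \<open>l\<close>, as a linear map on all
  of \<real>^m. It replaces the existential in \<open>freq_set\<close> by an integrality test; the
  group property then follows from linearity, and discreteness from linearity together with
  injectivity.\<close>

definition freq_vec :: "real ^ ('m::finite + 'n::finite) ^ ('m + 'n) \<Rightarrow> real ^ 'm \<Rightarrow> real ^ ('m + 'n)"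
  where "freq_vec M l = join ((1 / pi) *\<^sub>R l) 0 v* M"

text \<open>The hypotheses say that \<open>k v* matrix_inv M\<close> is the vector (l / pi, 0);
  multiplying by \<open>M\<close> gives back \<open>k\<close>.\<close>

lemma freq_vec_eqI:
  assumes "invertible M" and "\<And>j. l $ j = pi * (k \<bullet> (matrix_inv M *v axis (Inl j) 1))"
    and "\<And>i. k \<bullet> (matrix_inv M *v axis (Inr i) 1) = 0"
  shows "freq_vec M l = k"
proof -
  have "join ((1 / pi) *\<^sub>R l) 0 = k v* matrix_inv M"
    using assms(2,3) by (simp add: vec_sum_eq_iff inner_matrix_axis)
  then show ?thesis
    using assms(1) by (simp add: freq_vec_def vector_matrix_inv_mult)
qed

lemma mem_freq_set_iff:
  assumes M: "invertible M"
  shows "l \<in> freq_set M \<longleftrightarrow> freq_vec M l \<in> int_vecs"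
proof
  assume "l \<in> freq_set M"
  then obtain k where "l = (\<chi> j. pi * (k \<bullet> (matrix_inv M *v axis (Inl j) 1)))" and k: "k \<in> int_vecs"
    "\<forall>i. k \<bullet> (matrix_inv M *v axis (Inr i) 1) = 0"
    by (auto simp: freq_set_def)
  then show "freq_vec M l \<in> int_vecs"
    using freq_vec_eqI[OF M, of l k] by simp
next
  assume "freq_vec M l \<in> int_vecs"
  moreover have "freq_vec M l v* matrix_inv M = join ((1 / pi) *\<^sub>R l) 0"
    using M by (simp add: freq_vec_def vector_matrix_inv_mult)
  ultimately show "l \<in> freq_set M"
    unfolding freq_set_def
    by (intro CollectI exI[of _ "freq_vec M l"]) (simp add: inner_matrix_axis vec_eq_iff)
qed

lemma linear_freq_vec: "linear (freq_vec M)"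
proof -
  have "linear (\<lambda>l. join ((1 / pi) *\<^sub>R l) 0)"
    by (rule linearI) (auto simp: vec_sum_eq_iff algebra_simps)
  from linear_compose[OF this matrix_vector_mul_linear, of "transpose M"] show ?thesis
    by (simp add: freq_vec_def[abs_def] o_def)
qed

lemma inj_freq_vec:
  assumes "invertible M"
  shows "inj (freq_vec M)"
proof (rule injI)
  fix l l' :: "real ^ 'a" assume "freq_vec M l = freq_vec M l'"
  then have "join ((1 / pi) *\<^sub>R l) 0 = join ((1 / pi) *\<^sub>R l') (0 :: real ^ 'b)"
    unfolding freq_vec_def using assms by (metis vector_matrix_inv_mult(2))
  then show "l = l'" by (simp add: vec_sum_eq_iff vec_eq_iff)
qed

text \<open>Ensures that infinitely many frequencies give infinitely many functions. For d = l - l',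
  the phases at pi d / |d|^2 differ by pi, so the two values are opposite; being nonzero, they
  differ.\<close>

lemma inj_exponential: "inj (exponential :: real ^ 'k \<Rightarrow> _)"
proof (rule injI, rule ccontr)
  fix l l' :: "real ^ 'k"
  assume eq: "exponential l = exponential l'" and ne: "l \<noteq> l'"
  define d where "d = l - l'"
  define x where "x = (pi / (d \<bullet> d)) *\<^sub>R d"
  have "d \<bullet> x = pi" using ne by (simp add: x_def d_def)
  then have "l \<bullet> x = l' \<bullet> x + pi" by (simp add: d_def inner_diff_left)
  then have "exponential l x = exponential l' x * exp (\<i> * complex_of_real pi)"
    by (simp add: exponential_def distrib_left exp_add)
  also have "\<dots> = - exponential l' x" by (simp add: mult.commute[of \<i>])
  finally have "exponential l' x = 0" using eq by simp
  then show False by (simp add: exponential_def)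
qed

section \<open>The weight and Fubini\<close>

lemma weight_eq: "weight M x = (\<integral>y. indicator (cube_image M) (join x y) \<partial>lborel)"
  unfolding weight_def set_lebesgue_integral_def
  by (rule Bochner_Integration.integral_cong) (auto simp: fibre_def indicator_def)

text \<open>Lets the integral over the projection be taken over all of \<real>^m.\<close>

lemma weight_eq_0:
  assumes "x \<notin> proj_fst ` cube_image M"
  shows "weight M x = 0"
proof -
  have "join x y \<notin> cube_image M" for y
  proof
    assume "join x y \<in> cube_image M"
    moreover have "x = proj_fst (join x y)" by (simp add: proj_fst_def vec_eq_iff)
    ultimately show False using assms by blast
  qed
  then show ?thesis by (simp add: weight_eq)
qed

lemma compact_cube_image: "compact (cube_image M)"
  unfolding cube_image_def std_cube_eq_cbox
  by (intro compact_continuous_image linear_continuous_on matrix_vector_mul_bounded_linear compact_cbox)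

text \<open>The exponential with frequency (l, 0) does not depend on the last coordinates, so it
  leaves the inner Fubini integral, and what remains there is the weight. Integrability comes from
  continuity on a compact set.\<close>

lemma exponential_weight_integral:
  fixes M :: "real ^ ('m::finite + 'n::finite) ^ ('m + 'n)"
  defines "f \<equiv> \<lambda>l u. indicator (cube_image M) u *\<^sub>R exponential (join l 0) u"
  shows "set_integrable lborel (proj_fst ` cube_image M) (\<lambda>x. exponential l x * complex_of_real (weight M x))"
    and "(\<integral>x\<in>proj_fst ` cube_image M. exponential l x * complex_of_real (weight M x) \<partial>lborel)
      = (\<integral>u. f l u \<partial>lborel)"
proof -
  let ?J = "\<lambda>p. join (fst p) (snd p) :: real ^ ('m + 'n)"
  let ?P = "proj_fst ` cube_image M"
  let ?g = "\<lambda>x. exponential l x * complex_of_real (weight M x)"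
  have int: "integrable lborel (f l)"
    unfolding f_def by (intro borel_integrable_compact compact_cube_image continuous_on_exponential)
  then have [measurable]: "f l \<in> borel_measurable borel" by simp
  have intJ: "integrable (lborel \<Otimes>\<^sub>M lborel) (\<lambda>p. f l (?J p))"
    using int by (subst (asm) lborel_eq_distr_join) (simp add: integrable_distr_eq)
  have inner: "(\<integral>y. f l (join x y) \<partial>lborel) = ?g x" for x
  proof -
    have "f l (join x y) = exponential l x * complex_of_real (indicator (cube_image M) (join x y))" for y
      by (simp add: f_def exponential_def inner_join scaleR_conv_of_real mult.commute)
    then show ?thesis by (simp only: integral_mult_right_zero integral_complex_of_real weight_eq)
  qed
  have ind: "(\<lambda>x. indicator ?P x *\<^sub>R ?g x) = ?g"
  proof
    fix x show "indicator ?P x *\<^sub>R ?g x = ?g x"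
      by (cases "x \<in> ?P") (auto simp: weight_eq_0)
  qed
  show "set_integrable lborel ?P ?g"
    using lborel_pair.integrable_fst'[OF intJ] unfolding set_integrable_def ind by (simp add: inner)
  have "(\<integral>u. f l u \<partial>lborel) = (\<integral>p. f l (?J p) \<partial>(lborel \<Otimes>\<^sub>M lborel))"
    by (subst lborel_eq_distr_join) (simp add: integral_distr)
  also have "\<dots> = (\<integral>x. ?g x \<partial>lborel)"
    using lborel_pair.integral_fst'[OF intJ] by (simp add: inner)
  finally show "(\<integral>x\<in>?P. ?g x \<partial>lborel) = (\<integral>u. f l u \<partial>lborel)"
    by (simp add: set_lebesgue_integral_def ind)
qed

lemma integral_exponential_weight_eq_0:
  assumes M: "invertible M" and l: "l \<in> freq_set M" "l \<noteq> 0"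
  shows "(\<integral>x\<in>proj_fst ` cube_image M. exponential l x * complex_of_real (weight M x) \<partial>lborel) = 0"
proof -
  let ?f = "\<lambda>u. indicator (cube_image M) u *\<^sub>R exponential (join l 0) u"
  let ?k = "freq_vec M l"
  have [measurable]: "cube_image M \<in> sets borel"
    by (intro borel_compact compact_cube_image)
  have k: "?k \<in> int_vecs" "?k \<noteq> 0"
    using l M linear_0[OF linear_freq_vec, of M] inj_freq_vec[OF M]
    by (auto simp: mem_freq_set_iff inj_def)
  have jl: "join l 0 = pi *\<^sub>R join ((1 / pi) *\<^sub>R l) 0" by (simp add: vec_sum_eq_iff)
  \<comment> \<open>Under u = M v the matrix moves onto the frequency by transposition, which turns
    (l, 0) into pi times the integer vector \<open>?k\<close>.\<close>
  have "?f (M *v v) = indicator std_cube v *\<^sub>R exponential (pi *\<^sub>R ?k) v" for v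
  proof -
    have "M *v v \<in> cube_image M \<longleftrightarrow> v \<in> std_cube"
      using M unfolding cube_image_def
      by (metis (no_types, lifting) image_iff matrix_inv_mult(2) matrix_vector_mul_assoc matrix_vector_mul_lid)
    moreover have "join l 0 \<bullet> (M *v v) = (pi *\<^sub>R ?k) \<bullet> v"
      unfolding jl freq_vec_def
      by (simp add: dot_lmul_matrix[symmetric] scaleR_vector_matrix_assoc)
    ultimately show ?thesis by (simp add: exponential_def indicator_def)
  qed
  then have "(\<integral>u. ?f u \<partial>lborel) = 0"
    using integral_lborel_matrix_image[OF M, of ?f] integral_exponential_std_cube[OF k] by simp
  then show ?thesis by (simp add: exponential_weight_integral)
qed

section \<open>The sublattice spanned by the given vectors\<close>

text \<open>Column j of \<open>G\<close> is the frequency of \<open>k j\<close>, so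
  \<open>freq_vec M\<close> sends G z to the combination of the \<open>k j\<close> with coefficients
  z. Independence makes \<open>G\<close> injective, and integer coefficients give
  frequencies.\<close>

lemma freq_basis:
  fixes M :: "real ^ ('m::finite + 'n::finite) ^ ('m + 'n)" and k :: "'m \<Rightarrow> real ^ ('m + 'n)"
  assumes M: "invertible M" and int: "\<And>j. k j \<in> int_vecs"
    and inj: "inj k" and ind: "independent (range k)"
    and orth: "\<And>i j. k j \<bullet> (matrix_inv M *v axis (Inr i) 1) = 0"
  defines "G \<equiv> \<chi> i j. pi * (k j \<bullet> (matrix_inv M *v axis (Inl i) 1))"
  shows "invertible G" and "\<And>z. z \<in> int_vecs \<Longrightarrow> G *v z \<in> freq_set M"
    and "\<bar>det G\<bar> = pi ^ CARD('m) * (\<bar>det (U_matrix k M)\<bar> / \<bar>det M\<bar>)"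
proof -
  let ?N = "matrix_inv M"
  have fv: "freq_vec M (G *v z) = (\<Sum>j\<in>UNIV. z $ j *\<^sub>R k j)" for z
  proof (rule freq_vec_eqI[OF M])
    show "(G *v z) $ i = pi * ((\<Sum>j\<in>UNIV. z $ j *\<^sub>R k j) \<bullet> (?N *v axis (Inl i) 1))" for i
      by (simp add: G_def matrix_vector_mult_def inner_sum_left sum_distrib_left mult_ac)
    show "(\<Sum>j\<in>UNIV. z $ j *\<^sub>R k j) \<bullet> (?N *v axis (Inr i) 1) = 0" for i
      by (simp add: inner_sum_left orth)
  qed
  show G: "invertible G"
  proof (rule invertible_ker)
    fix z assume "G *v z = 0"
    then have "(\<Sum>j\<in>UNIV. z $ j *\<^sub>R k j) = 0"
      using fv[of z] linear_0[OF linear_freq_vec, of M] by simp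
    \<comment> \<open>Independence concerns the set \<open>range k\<close>, so the sum over indices
      is rewritten as a sum over vectors; this uses the injectivity of \<open>k\<close>.\<close>
    then have "(\<Sum>v\<in>range k. z $ (inv k v) *\<^sub>R v) = 0"
      using inj by (subst sum.reindex) auto
    then have "z $ (inv k (k j)) = 0" for j
      using independentD[OF ind, of "range k" "\<lambda>v. z $ inv k v" "k j"] by auto
    then show "z = 0" using inj by (simp add: vec_eq_iff)
  qed
  show "G *v z \<in> freq_set M" if "z \<in> int_vecs" for z
    using that int unfolding mem_freq_set_iff[OF M] fv
    by (auto simp: int_vecs_def intro!: Ints_sum)
  \<comment> \<open>The upper left block of U M^(-1). Its m rows, each scaled by pi, form the
    transpose of \<open>G\<close>, which accounts for the factor pi^m.\<close>
  define A :: "real ^ 'm ^ 'm" where "A = (\<chi> j i. k j \<bullet> (?N *v axis (Inl i) 1))"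
  have "transpose G = (\<chi> j. pi *s A $ j)"
    by (simp add: G_def A_def transpose_def vec_eq_iff)
  then have detG: "det G = pi ^ CARD('m) * det A"
    using det_rows_mul[of "\<lambda>_. pi" "\<lambda>j. A $ j"] by (metis (no_types) det_transpose prod_constant vec_lambda_eta)
  then have A: "invertible A" using G by (simp add: invertible_det_nz)
  have "(U_matrix k M ** ?N) *v join x y = join (A *v x) y" for x :: "real ^ 'm" and y :: "real ^ 'n"
  proof -
    define B where "B = U_matrix k M ** ?N"
    have "B $ Inl j $ r = k j \<bullet> (?N *v axis r 1)" for j r
      by (simp add: B_def matrix_matrix_mult_def U_matrix_def matrix_vector_mult_basis column_def inner_vec_def)
    then have Inl: "B $ Inl j $ Inl i = A $ j $ i" "B $ Inl j $ Inr i' = 0" for j i i'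
      by (simp_all add: A_def orth)
    \<comment> \<open>The last rows of \<open>U_matrix k M\<close> are rows of \<open>M\<close>, so
      multiplication by the inverse turns them into rows of the identity. The upper right block
      vanishes by \<open>orth\<close>.\<close>
    have "B $ Inr i = (mat 1 :: real ^ ('m + 'n) ^ ('m + 'n)) $ Inr i" for i
      unfolding matrix_inv_mult(1)[OF M, symmetric]
      by (simp add: B_def matrix_matrix_mult_def U_matrix_def row_def vec_eq_iff)
    then have Inr: "B $ Inr i $ Inl j = 0" "B $ Inr i $ Inr i' = (if i' = i then 1 else 0)" for i j i'
      by (simp_all add: mat_def)
    show ?thesis unfolding B_def[symmetric]
      by (simp add: vec_sum_eq_iff matrix_vector_mult_def sum_UNIV_sum Inl Inr if_distrib[of "\<lambda>t. t * _"]
          cong: if_cong)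
  qed
  then have "\<bar>det (U_matrix k M ** ?N)\<bar> = \<bar>det A\<bar>"
    by (rule abs_det_block[OF A])
  moreover have "det M * det ?N = 1"
    using M by (metis det_I det_mul matrix_inv_mult(1))
  then have "det ?N = 1 / det M"
    by (metis mult_zero_left nonzero_mult_div_cancel_left zero_neq_one)
  ultimately show "\<bar>det G\<bar> = pi ^ CARD('m) * (\<bar>det (U_matrix k M)\<bar> / \<bar>det M\<bar>)"
    using detG by (simp add: det_mul abs_mult)
qed

section \<open>Orthogonality, infinitude and density combined\<close>

theorem theorem2p5:
  fixes M :: "real ^ ('m::finite + 'n::finite) ^ ('m + 'n)"
    and k :: "'m \<Rightarrow> real ^ ('m + 'n)"
  assumes "invertible M"
    and "\<And>j. k j \<in> int_vecs - {0}"
    and "inj k" and "independent (range k)"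
    and "\<And>i j. k j \<bullet> (matrix_inv M *v axis (Inr i) 1) = 0"
  defines "P \<equiv> proj_fst ` cube_image M"
    and "L \<equiv> freq_set M"
  shows "infinite (exponential ` L) \<and>
    (\<forall>l\<in>L. \<forall>l'\<in>L. l \<noteq> l' \<longrightarrow>
      set_integrable lborel P (\<lambda>x. exponential (l - l') x * complex_of_real (weight M x)) \<and>
      (\<integral>x\<in>P. exponential (l - l') x * complex_of_real (weight M x) \<partial>lborel) = 0) \<and>
    (\<exists>\<delta>. has_density L \<delta> \<and>
      \<delta> \<ge> (1 / pi ^ CARD('m + 'n)) * (\<bar>det M\<bar> / \<bar>det (U_matrix k M)\<bar>))"
proof (intro conjI ballI impI)
  note M = \<open>invertible M\<close>
  define G :: "real ^ 'm ^ 'm" where "G = (\<chi> i j. pi * (k j \<bullet> (matrix_inv M *v axis (Inl i) 1)))"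
  have G: "invertible G" "\<And>z. z \<in> int_vecs \<Longrightarrow> G *v z \<in> L"
    "\<bar>det G\<bar> = pi ^ CARD('m) * (\<bar>det (U_matrix k M)\<bar> / \<bar>det M\<bar>)"
    using freq_basis[OF M, of k] assms(2-5) unfolding G_def L_def by auto
  have L: "l \<in> L \<longleftrightarrow> freq_vec M l \<in> int_vecs" for l
    unfolding L_def by (rule mem_freq_set_iff[OF M])
  have add: "a + b \<in> L" and diff: "a - b \<in> L" if "a \<in> L" "b \<in> L" for a b
    using that by (simp_all add: L linear_add[OF linear_freq_vec] linear_diff[OF linear_freq_vec]
        int_vecs_add int_vecs_diff)
  \<comment> \<open>Discreteness: \<open>freq_vec M\<close> maps the frequencies in a bounded set
    injectively to integer vectors in a bounded set.\<close>
  have fin: "finite (L \<inter> S)" if "bounded S" for S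
  proof -
    have "finite (int_vecs \<inter> freq_vec M ` S)"
      using that by (intro finite_int_vecs_Int_bounded bounded_linear_image
          linear_conv_bounded_linear[THEN iffD1, OF linear_freq_vec])
    then have "finite (freq_vec M ` (L \<inter> S))"
      by (rule rev_finite_subset) (auto simp: L)
    then show ?thesis
      by (rule finite_imageD) (rule inj_on_subset[OF inj_freq_vec[OF M]], simp)
  qed
  \<comment> \<open>Finitely many exponentials would leave finitely many frequencies, yet these
    contain the injective image of the integer vectors under \<open>G\<close>.\<close>
  show "infinite (exponential ` L)"
  proof
    assume "finite (exponential ` L)"
    then have "finite L"
      by (rule finite_imageD) (rule inj_on_subset[OF inj_exponential], simp)
    then have "finite ((*v) G ` int_vecs)"
      by (rule rev_finite_subset) (use G(2) in auto)
    moreover have "inj ((*v) G)"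
      using G(1) by (metis injI matrix_inv_mult(2) matrix_vector_mul_assoc matrix_vector_mul_lid)
    ultimately have "finite (int_vecs :: (real ^ 'm) set)"
      by (meson finite_imageD inj_on_subset subset_UNIV)
    then show False by (rule notE[OF infinite_int_vecs])
  qed
  show "set_integrable lborel P (\<lambda>x. exponential (l - l') x * complex_of_real (weight M x))" for l l'
    unfolding P_def by (rule exponential_weight_integral)
  \<comment> \<open>The difference of two distinct frequencies is again a nonzero frequency, so
    orthogonality is the vanishing of a single integral.\<close>
  show "(\<integral>x\<in>P. exponential (l - l') x * complex_of_real (weight M x) \<partial>lborel) = 0"
    if "l \<in> L" "l' \<in> L" "l \<noteq> l'" for l l'
    unfolding P_def using diff[OF that(1,2)] that(3)
    by (intro integral_exponential_weight_eq_0[OF M]) (auto simp: L_def)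
  obtain \<delta> where \<delta>: "has_density L \<delta>" "1 / \<bar>det G\<bar> \<le> \<delta>"
    using lattice_has_density[OF G(1,2) add diff fin] by blast
  have "1 / pi ^ CARD('m + 'n) * (\<bar>det M\<bar> / \<bar>det (U_matrix k M)\<bar>)
      \<le> 1 / pi ^ CARD('m) * (\<bar>det M\<bar> / \<bar>det (U_matrix k M)\<bar>)"
    using pi_ge_two by (intro mult_right_mono divide_left_mono power_increasing) auto
  also have "\<dots> = 1 / \<bar>det G\<bar>" by (simp add: G(3))
  finally show "\<exists>\<delta>. has_density L \<delta> \<and>
      1 / pi ^ CARD('m + 'n) * (\<bar>det M\<bar> / \<bar>det (U_matrix k M)\<bar>) \<le> \<delta>"
    using \<delta> by auto
qed

end
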